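(* Consider the planar $n$-body problem with masses $m_1,\dots,m_n>0$ and a potential $U$ that depends only on the mutual distances $r_{ij}=|\mathbf r_i-\mathbf r_j|$, $1\le i<j\le n$. Let $x(t)=(\mathbf r_1(t),\dots,\mathbf r_n(t))$ be a solution, defined on a time interval, which is collinear and has non-zero total angular momentum. Then $x(t)$ is homographic.
   Context: Setting: $n$ bodies $P_1,\dots,P_n$ with masses $m_i>0$ move in the plane $\mathbb R^2$. Positions $\mathbf r_i=(x_i,y_i)$ are taken with respect to the center of mass, so $\sum_i m_i\mathbf r_i=0$. The potential depends on the mutual distances alone: $U(\mathbf r_1,\dots,\mathbf r_n)=V\big((r_{ij})_{i<j}\big)$ with $V:(0,\infty)^{n(n-1)/2}\to\mathbb R$ of class $C^1$. A solution is a twice differentiable collision-free curve ($r_{ij}(t)>0$ for all $i\neq j$ and all $t$) on an interval, satisfying $m_i\ddot{\mathbf r}_i=-\partial U/\partial\mathbf r_i$ for $i=1,\dots,n$. Collinear solution: at every time $t$ all bodies lie on a common line (which then passes through the center of mass), and this line may rotate in the plane about the center of mass. Total angular momentum: the quantity $K=\sum_{i=1}^n m_i(x_i\dot y_i-y_i\dot x_i)$, which is constant along solutions. Homographic solution: fixing an initial instant $t_0$ and writing $\mathbf r_i^0=\mathbf r_i(t_0)$, there exist for every $t$ a scalar $\nu(t)>0$ and an orthogonal $2\times2$ matrix $\Omega(t)$, both independent of $i$, such that $\mathbf r_i(t)=\nu(t)\Omega(t)\mathbf r_i^0$ for every $i$ and every $t$. *)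

theory Defs
  imports "HOL-Analysis.Analysis"
begin

text \<open>
  Bodies are indexed by \<open>{1..n}\<close>; a configuration is a map \<open>nat \<Rightarrow> real^2\<close>, of which only the
  values on \<open>{1..n}\<close> matter. A motion \<open>r\<close> assigns to each time \<open>t\<close> the configuration \<open>r t\<close>.
\<close>

definition pairs :: "nat \<Rightarrow> (nat \<times> nat) set" where
  "pairs n = {(i, j). 1 \<le> i \<and> i < j \<and> j \<le> n}"

text \<open>
  The open orthant \<open>(0,\<infinity>)\<close> to the power \<open>n (n - 1) / 2\<close>. Its elements are extensional outside
  \<open>pairs n\<close>, so the product topology on functions induces the Euclidean topology on it.
\<close>

definition pos_orthant :: "nat \<Rightarrow> (nat \<times> nat \<Rightarrow> real) set" where
  "pos_orthant n = pairs n \<rightarrow>\<^sub>E {0<..}"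

definition C1_on_orthant :: "nat \<Rightarrow> ((nat \<times> nat \<Rightarrow> real) \<Rightarrow> real) \<Rightarrow> bool" where
  "C1_on_orthant n V \<longleftrightarrow>
     (\<exists>V'. \<forall>p\<in>pairs n.
        (\<forall>d\<in>pos_orthant n. ((\<lambda>s. V (d(p := s))) has_real_derivative V' p d) (at (d p))) \<and>
        continuous_on (pos_orthant n) (V' p))"

definition mutual_dists :: "nat \<Rightarrow> (nat \<Rightarrow> real^2) \<Rightarrow> (nat \<times> nat \<Rightarrow> real)" where
  "mutual_dists n x = (\<lambda>(i, j)\<in>pairs n. dist (x i) (x j))"

definition potential ::
  "nat \<Rightarrow> ((nat \<times> nat \<Rightarrow> real) \<Rightarrow> real) \<Rightarrow> (nat \<Rightarrow> real^2) \<Rightarrow> real" where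
  "potential n V x = V (mutual_dists n x)"

text \<open>
  Derivatives are taken within \<open>T\<close>, hence one-sided at an endpoint belonging to \<open>T\<close>. The vector
  \<open>g\<close> is the partial gradient of the potential with respect to the position of body \<open>i\<close>; it
  exists at every collision-free configuration when \<open>V\<close> is of class \<open>C\<^sup>1\<close>.
\<close>

definition nbody_solution ::
  "nat \<Rightarrow> (nat \<Rightarrow> real) \<Rightarrow> ((nat \<times> nat \<Rightarrow> real) \<Rightarrow> real) \<Rightarrow> real set
     \<Rightarrow> (real \<Rightarrow> nat \<Rightarrow> real^2) \<Rightarrow> bool" where
  "nbody_solution n m V T r \<longleftrightarrow>
     (\<forall>t\<in>T. \<forall>i\<in>{1..n}. \<forall>j\<in>{1..n}. i \<noteq> j \<longrightarrow> dist (r t i) (r t j) > 0) \<and>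
     (\<forall>t\<in>T. (\<Sum>i=1..n. m i *\<^sub>R r t i) = 0) \<and>
     (\<exists>v a. \<forall>t\<in>T. \<forall>i\<in>{1..n}.
        ((\<lambda>s. r s i) has_vector_derivative v t i) (at t within T) \<and>
        ((\<lambda>s. v s i) has_vector_derivative a t i) (at t within T) \<and>
        (\<exists>g. GDERIV (\<lambda>q. potential n V ((r t)(i := q))) (r t i) :> g \<and>
             m i *\<^sub>R a t i = - g))"

definition collinear_motion :: "nat \<Rightarrow> real set \<Rightarrow> (real \<Rightarrow> nat \<Rightarrow> real^2) \<Rightarrow> bool" where
  "collinear_motion n T r \<longleftrightarrow> (\<forall>t\<in>T. collinear (r t ` {1..n}))"

definition angular_momentum ::
  "nat \<Rightarrow> (nat \<Rightarrow> real) \<Rightarrow> real set \<Rightarrow> (real \<Rightarrow> nat \<Rightarrow> real^2) \<Rightarrow> real \<Rightarrow> real" where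
  "angular_momentum n m T r t =
     (\<Sum>i=1..n. let v = vector_derivative (\<lambda>s. r s i) (at t within T)
                in m i * (r t i $ 1 * v $ 2 - r t i $ 2 * v $ 1))"

definition homographic :: "nat \<Rightarrow> real set \<Rightarrow> real \<Rightarrow> (real \<Rightarrow> nat \<Rightarrow> real^2) \<Rightarrow> bool" where
  "homographic n T t0 r \<longleftrightarrow>
     (\<forall>t\<in>T. \<exists>\<nu>::real. \<exists>\<Omega>::real^2^2. \<nu> > 0 \<and> orthogonal_matrix \<Omega> \<and>
        (\<forall>i\<in>{1..n}. r t i = \<nu> *\<^sub>R (\<Omega> *v r t0 i)))"

end

theory Submission
  imports Defs
begin

text \<open>
  Write \<open>x \<times> y\<close> for the planar cross product. At a collinear configuration the potential is even
  under reflection in the line, so the acceleration of every body points along the line: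
  \<open>r\<^sub>i \<times> a\<^sub>j = 0\<close>. Differentiating \<open>r\<^sub>i \<times> r\<^sub>j = 0\<close> gives \<open>r\<^sub>i \<times> v\<^sub>j = r\<^sub>j \<times> v\<^sub>i\<close>, and differentiating once
  more gives \<open>v\<^sub>i \<times> v\<^sub>j = v\<^sub>j \<times> v\<^sub>i\<close>, hence \<open>v\<^sub>i \<times> v\<^sub>j = 0\<close>. Therefore each \<open>r\<^sub>i \<times> v\<^sub>j\<close> is constant. Non-zero
  angular momentum provides a body \<open>l\<close> with \<open>r\<^sub>l \<times> v\<^sub>l \<noteq> 0\<close>; as \<open>r\<^sub>i = \<lambda>\<^sub>i r\<^sub>l\<close> with
  \<open>\<lambda>\<^sub>i = (r\<^sub>i \<times> v\<^sub>l) / (r\<^sub>l \<times> v\<^sub>l)\<close>, the ratios \<open>\<lambda>\<^sub>i\<close> are constant.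
\<close>

definition cross2 :: "real^2 \<Rightarrow> real^2 \<Rightarrow> real" where
  "cross2 x y = x $ 1 * y $ 2 - x $ 2 * y $ 1"

lemma cross2_self [simp]: "cross2 x x = 0"
  by (simp add: cross2_def)

lemma cross2_commute: "cross2 x y = - cross2 y x"
  by (simp add: cross2_def)

lemma cross2_scaleR_left [simp]: "cross2 (c *\<^sub>R x) y = c * cross2 x y"
  by (simp add: cross2_def algebra_simps)

lemma cross2_scaleR_right [simp]: "cross2 x (c *\<^sub>R y) = c * cross2 x y"
  by (simp add: cross2_def algebra_simps)

text \<open>The vector on the right is \<open>x\<close> turned by a quarter turn. This translates
  statements about orthogonality into statements about parallelism.\<close>

lemma cross2_eq_inner: "cross2 x y = vector [- x $ 2, x $ 1] \<bullet> y"
  by (simp add: cross2_def inner_vec_def sum_2)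

lemma has_vector_derivative_cross2:
  assumes "(f has_vector_derivative f') (at t within S)"
    and "(g has_vector_derivative g') (at t within S)"
  shows "((\<lambda>s. cross2 (f s) (g s)) has_vector_derivative
           cross2 f' (g t) + cross2 (f t) g') (at t within S)"
proof -
  note c = bounded_linear.has_vector_derivative[OF bounded_linear_vec_nth]
  show ?thesis
    unfolding cross2_def
    using has_vector_derivative_diff[OF has_vector_derivative_mult[OF c[OF assms(1)] c[OF assms(2)]]
        has_vector_derivative_mult[OF c[OF assms(1)] c[OF assms(2)]], of 1 2 2 1]
    by (simp add: algebra_simps)
qed

lemma parallel_eq_scaleR:
  assumes "cross2 x y = 0" "y \<noteq> 0"
  obtains c where "x = c *\<^sub>R y"
proof (cases "y $ 1 = 0")
  case True
  with assms(2) have "y $ 2 \<noteq> 0" by (auto simp: vec_eq_iff forall_2)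
  with True assms(1) have "x = (x $ 2 / y $ 2) *\<^sub>R y"
    by (auto simp: vec_eq_iff forall_2 cross2_def field_simps)
  then show ?thesis by (rule that)
next
  case False
  with assms(1) have "x = (x $ 1 / y $ 1) *\<^sub>R y"
    by (auto simp: vec_eq_iff forall_2 cross2_def field_simps)
  then show ?thesis by (rule that)
qed

text \<open>By evenness, moving from \<open>x\<close> along \<open>p\<close> or along
  \<open>- p\<close> yields the same function of \<open>s\<close>, so its derivative at 0 is both
  \<open>p \<bullet> g\<close> and \<open>- p \<bullet> g\<close>.\<close>

lemma even_imp_GDERIV_orthogonal:
  fixes f :: "'a::real_inner \<Rightarrow> real"
  assumes "GDERIV f x :> g" and "\<And>s. f (x + s *\<^sub>R p) = f (x - s *\<^sub>R p)"
  shows "p \<bullet> g = 0"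
proof -
  have "((\<lambda>s. f (x + s *\<^sub>R q)) has_real_derivative q \<bullet> g) (at 0)" for q
  proof -
    have "(f has_derivative (\<lambda>h. h \<bullet> g)) (at (x + 0 *\<^sub>R q))"
      using assms(1) by (simp add: gderiv_def)
    moreover have "((\<lambda>s. x + s *\<^sub>R q) has_derivative (\<lambda>s. s *\<^sub>R q)) (at 0)"
      by (auto intro!: derivative_eq_intros)
    ultimately have "((\<lambda>s. f (x + s *\<^sub>R q)) has_derivative (\<lambda>s. (s *\<^sub>R q) \<bullet> g)) (at 0)"
      by (rule has_derivative_compose[rotated])
    moreover have "(\<lambda>s. (s *\<^sub>R q) \<bullet> g) = (*) (q \<bullet> g)"
      by (simp add: fun_eq_iff)
    ultimately show ?thesis
      by (simp add: has_field_derivative_def)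
  qed
  from this[of p] this[of "- p"] have "p \<bullet> g = - p \<bullet> g"
    using assms(2) by (intro DERIV_unique[of "\<lambda>s. f (x + s *\<^sub>R p)"]) simp_all
  then show ?thesis
    by simp
qed

text \<open>Every \<open>x j\<close> is orthogonal to \<open>p\<close>, so by Pythagoras displacing
  body \<open>i\<close> by \<open>s *\<^sub>R p\<close> or by its negative gives the same distances
  to the other bodies. The potential is therefore even in \<open>s\<close>.\<close>

lemma GDERIV_potential_orthogonal:
  assumes "GDERIV (\<lambda>q. potential n V (x(i := q))) (x i) :> g"
    and i: "i \<in> {1..n}" and x: "\<And>j. j \<in> {1..n} \<Longrightarrow> x j = c j *\<^sub>R u" and p: "p \<bullet> u = 0"
  shows "p \<bullet> g = 0"
proof (rule even_imp_GDERIV_orthogonal[OF assms(1)])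
  fix s
  have reflect: "dist (x i + s *\<^sub>R p) (x j) = dist (x i - s *\<^sub>R p) (x j)" if "j \<in> {1..n}" for j
  proof -
    have "u \<bullet> p = 0"
      using p by (simp add: inner_commute)
    then show ?thesis
      unfolding dist_norm norm_eq x[OF that] x[OF i]
      using p by (simp add: inner_diff inner_add)
  qed
  have "mutual_dists n (x(i := x i + s *\<^sub>R p)) = mutual_dists n (x(i := x i - s *\<^sub>R p))"
    unfolding mutual_dists_def
  proof (rule restrict_ext, clarify)
    fix j k assume "(j, k) \<in> pairs n"
    then have "j \<in> {1..n}" "k \<in> {1..n}" "j \<noteq> k"
      by (auto simp: pairs_def)
    then show "dist ((x(i := x i + s *\<^sub>R p)) j) ((x(i := x i + s *\<^sub>R p)) k) =
        dist ((x(i := x i - s *\<^sub>R p)) j) ((x(i := x i - s *\<^sub>R p)) k)"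
      using reflect[of j] reflect[of k] by (auto simp: dist_commute[of "x j"])
  qed
  then show "potential n V (x(i := x i + s *\<^sub>R p)) = potential n V (x(i := x i - s *\<^sub>R p))"
    by (simp add: potential_def)
qed

text \<open>Collinearity only makes differences multiples of \<open>u\<close>. Because the weighted
  sum vanishes, \<open>sum m I *\<^sub>R x i\<close> is the weighted sum of the differences
  \<open>x i - x j\<close>, and the total mass is positive.\<close>

lemma collinear_centered_imp_multiples:
  fixes x :: "'i \<Rightarrow> 'a::real_vector"
  assumes "finite I" and m: "\<And>i. i \<in> I \<Longrightarrow> m i > 0"
    and "(\<Sum>i\<in>I. m i *\<^sub>R x i) = 0" and "collinear (x ` I)"
  obtains u c where "\<And>i. i \<in> I \<Longrightarrow> x i = c i *\<^sub>R u"
proof -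
  obtain u where u: "\<And>i j. i \<in> I \<Longrightarrow> j \<in> I \<Longrightarrow> \<exists>c. x i - x j = c *\<^sub>R u"
    using assms(4) unfolding collinear_def by blast
  have "\<exists>c. x i = c *\<^sub>R u" if i: "i \<in> I" for i
  proof -
    obtain d where d: "\<And>j. j \<in> I \<Longrightarrow> x i - x j = d j *\<^sub>R u"
      using u[OF i] by metis
    have "sum m I *\<^sub>R x i = (\<Sum>j\<in>I. m j *\<^sub>R (x i - x j))"
      using assms(3) by (simp add: scaleR_diff_right sum_subtractf scaleR_sum_left)
    also have "\<dots> = (\<Sum>j\<in>I. m j * d j) *\<^sub>R u"
      by (simp add: d scaleR_sum_left)
    finally have "sum m I *\<^sub>R x i = (\<Sum>j\<in>I. m j * d j) *\<^sub>R u" .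
    moreover have M: "sum m I > 0"
      using assms(1) m i by (intro sum_pos) auto
    moreover have "x i = (1 / sum m I) *\<^sub>R (sum m I *\<^sub>R x i)"
      using M by simp
    ultimately have "x i = ((\<Sum>j\<in>I. m j * d j) / sum m I) *\<^sub>R u"
      by (metis (no_types, lifting) scaleR_scaleR times_divide_eq_left mult_1)
    then show ?thesis ..
  qed
  then show ?thesis using that by metis
qed

text \<open>The ratio of the norms gives the scale; an orthogonal map then takes \<open>x\<close> to
  the rescaled \<open>y\<close>, which has the same norm.\<close>

lemma exists_similarity:
  fixes x y :: "real^'n"
  assumes "x \<noteq> 0" "y \<noteq> 0"
  obtains \<nu> :: real and \<Omega> :: "real^'n^'n"
  where "\<nu> > 0" "orthogonal_matrix \<Omega>" "y = \<nu> *\<^sub>R (\<Omega> *v x)"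
proof -
  define \<nu> where "\<nu> = norm y / norm x"
  have \<nu>: "\<nu> > 0" using assms by (simp add: \<nu>_def)
  have "norm x = norm ((1 / \<nu>) *\<^sub>R y)"
    using assms by (simp add: \<nu>_def)
  then obtain f where f: "orthogonal_transformation f" "f x = (1 / \<nu>) *\<^sub>R y"
    by (rule orthogonal_transformation_exists)
  have "matrix f *v x = f x"
    using f(1) by (simp add: orthogonal_transformation_linear matrix_works linear_matrix_vector_mul_eq)
  moreover have "orthogonal_matrix (matrix f)"
    using f(1) by (simp add: orthogonal_transformation_matrix)
  ultimately show ?thesis
    using \<nu> f(2) by (intro that[of \<nu> "matrix f"]) auto
qed

text \<open>Derivatives within \<open>T\<close> are unique at limit points of \<open>T\<close>. A
  connected set with more than one point has no isolated points, endpoints included.\<close>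

lemma interval_at_within_nontrivial:
  fixes T :: "real set"
  assumes "is_interval T" "interior T \<noteq> {}" "t \<in> T"
  shows "at t within T \<noteq> bot"
proof -
  have "\<nexists>a. T = {a}"
    using assms(2) by auto
  then show ?thesis
    using assms connected_imp_perfect[of T t]
    by (auto simp: is_interval_connected_1 trivial_limit_within)
qed

theorem theorem1:
  fixes n :: nat
    and m :: "nat \<Rightarrow> real"
    and V :: "(nat \<times> nat \<Rightarrow> real) \<Rightarrow> real"
    and T :: "real set"
    and r :: "real \<Rightarrow> nat \<Rightarrow> real^2"
    and t0 :: real
  assumes "\<And>i. i \<in> {1..n} \<Longrightarrow> m i > 0"
    and "C1_on_orthant n V"
    and "is_interval T" and "interior T \<noteq> {}"
    and "nbody_solution n m V T r"
    and "collinear_motion n T r"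
    and "\<exists>t\<in>T. angular_momentum n m T r t \<noteq> 0"
    and "t0 \<in> T"
  shows "homographic n T t0 r"
proof -
  let ?I = "{1..n}"
  obtain v a where va: "\<forall>t\<in>T. \<forall>i\<in>?I.
        ((\<lambda>s. r s i) has_vector_derivative v t i) (at t within T) \<and>
        ((\<lambda>s. v s i) has_vector_derivative a t i) (at t within T) \<and>
        (\<exists>g. GDERIV (\<lambda>q. potential n V ((r t)(i := q))) (r t i) :> g \<and> m i *\<^sub>R a t i = - g)"
    using assms(5) unfolding nbody_solution_def by (elim conjE exE)
  have v: "((\<lambda>s. r s i) has_vector_derivative v t i) (at t within T)"
    and a: "((\<lambda>s. v s i) has_vector_derivative a t i) (at t within T)"
    and newton: "\<exists>g. GDERIV (\<lambda>q. potential n V ((r t)(i := q))) (r t i) :> g \<and>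
      m i *\<^sub>R a t i = - g"
    if "t \<in> T" "i \<in> ?I" for t i
    using bspec[OF bspec[OF va that(1)] that(2)] by blast+
  have com: "(\<Sum>i\<in>?I. m i *\<^sub>R r t i) = 0" if "t \<in> T" for t
    using assms(5) that by (simp add: nbody_solution_def)
  note nontriv = interval_at_within_nontrivial[OF assms(3,4)]
  \<comment> \<open>Identities between motions hold only on \<open>T\<close>, so they are
    differentiated within \<open>T\<close>.\<close>
  have deriv_unique: "d = d'"
    if "t \<in> T" "(f has_vector_derivative d) (at t within T)"
      "(g has_vector_derivative d') (at t within T)" "\<And>s. s \<in> T \<Longrightarrow> f s = g s"
    for t d d' and f g :: "real \<Rightarrow> real"
  proof -
    have "(f has_vector_derivative d') (at t within T)"
      using that by (metis has_vector_derivative_transform)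
    then show ?thesis
      using vector_derivative_within[OF nontriv] that by metis
  qed

  have rr: "cross2 (r t i) (r t j) = 0" and ra: "cross2 (r t i) (a t j) = 0"
    if t: "t \<in> T" and i: "i \<in> ?I" and j: "j \<in> ?I" for t i j
  proof -
    have coll: "collinear (r t ` ?I)"
      using assms(6) t by (simp add: collinear_motion_def)
    obtain u c where u: "\<And>i. i \<in> ?I \<Longrightarrow> r t i = c i *\<^sub>R u"
      by (rule collinear_centered_imp_multiples[OF finite_atLeastAtMost assms(1) com[OF t] coll]) (assumption, rule that)
    show "cross2 (r t i) (r t j) = 0"
      by (simp add: u[OF i] u[OF j])
    obtain g where g: "GDERIV (\<lambda>q. potential n V ((r t)(j := q))) (r t j) :> g"
      "m j *\<^sub>R a t j = - g"
      using newton[OF t j] by blast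
    \<comment> \<open>The orthogonality lemma is applied with \<open>p\<close> the quarter turn of
      \<open>u\<close>.\<close>
    have "cross2 u g = 0"
      unfolding cross2_eq_inner
      by (rule GDERIV_potential_orthogonal[OF g(1) j u])
         (simp_all add: cross2_eq_inner[symmetric])
    moreover have "m j * cross2 u (a t j) = cross2 u (- g)"
      by (simp flip: g(2))
    ultimately have "m j * cross2 u (a t j) = 0"
      by (simp add: cross2_eq_inner)
    then show "cross2 (r t i) (a t j) = 0"
      using assms(1)[OF j] by (simp add: u[OF i])
  qed

  have rv_sym: "cross2 (r t i) (v t j) = cross2 (r t j) (v t i)"
    if t: "t \<in> T" and i: "i \<in> ?I" and j: "j \<in> ?I" for t i j
  proof -
    have "cross2 (v t i) (r t j) + cross2 (r t i) (v t j) = 0"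
      by (rule deriv_unique[OF t has_vector_derivative_cross2[OF v[OF t i] v[OF t j]]
            has_vector_derivative_const[of 0]])
         (rule rr[OF _ i j])
    then show ?thesis
      using cross2_commute[of "v t i"] by simp
  qed

  have rv_deriv: "((\<lambda>s. cross2 (r s i) (v s j)) has_vector_derivative cross2 (v t i) (v t j))
      (at t within T)"
    if t: "t \<in> T" and i: "i \<in> ?I" and j: "j \<in> ?I" for t i j
    using has_vector_derivative_cross2[OF v[OF t i] a[OF t j]] ra[OF t i j] by simp

  have vv: "cross2 (v t i) (v t j) = 0"
    if t: "t \<in> T" and i: "i \<in> ?I" and j: "j \<in> ?I" for t i j
  proof -
    \<comment> \<open>By \<open>rv_sym\<close> both sides are derivatives of the same function on
      \<open>T\<close>; antisymmetry of \<open>cross2\<close> then forces the value 0.\<close>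
    have "cross2 (v t i) (v t j) = cross2 (v t j) (v t i)"
      by (rule deriv_unique[OF t rv_deriv[OF t i j] rv_deriv[OF t j i]]) (rule rv_sym[OF _ i j])
    then show ?thesis
      using cross2_commute[of "v t i"] by simp
  qed

  have rv_const: "cross2 (r t i) (v t j) = cross2 (r s i) (v s j)"
    if t: "t \<in> T" and s: "s \<in> T" and i: "i \<in> ?I" and j: "j \<in> ?I" for t s i j
  proof -
    have "((\<lambda>s. cross2 (r s i) (v s j)) has_vector_derivative 0) (at t within T)" if "t \<in> T" for t
      using rv_deriv[OF that i j] vv[OF that i j] by simp
    with is_interval_convex[OF assms(3)]
    obtain c where "\<And>t. t \<in> T \<Longrightarrow> cross2 (r t i) (v t j) = c"
      by (rule has_vector_derivative_zero_constant) (assumption, rule that)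
    then show ?thesis using t s by metis
  qed

  obtain t1 l where t1: "t1 \<in> T" and l: "l \<in> ?I" and "cross2 (r t1 l) (v t1 l) \<noteq> 0"
  proof -
    obtain t1 where t1: "t1 \<in> T" "angular_momentum n m T r t1 \<noteq> 0"
      using assms(7) by blast
    have "angular_momentum n m T r t1 = (\<Sum>i\<in>?I. m i * cross2 (r t1 i) (v t1 i))"
      unfolding angular_momentum_def Let_def cross2_def
      using vector_derivative_within[OF nontriv[OF t1(1)] v[OF t1(1)]]
      by (intro sum.cong) simp_all
    with t1 that show ?thesis
      by (metis (no_types, lifting) mult_zero_right sum.neutral)
  qed
  then have k: "cross2 (r t l) (v t l) \<noteq> 0" if "t \<in> T" for t
    using rv_const[OF that t1 l l] by simp
  then have rl: "r t l \<noteq> 0" if "t \<in> T" for t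
    using that by (force simp: cross2_def)

  \<comment> \<open>The ratio of body \<open>i\<close> to body \<open>l\<close>, read off at
    \<open>t0\<close>; \<open>rv_const\<close> makes numerator and denominator the same at every
    other time.\<close>
  define \<mu> where "\<mu> i = cross2 (r t0 i) (v t0 l) / cross2 (r t0 l) (v t0 l)" for i
  have ratio: "r t i = \<mu> i *\<^sub>R r t l" if t: "t \<in> T" and i: "i \<in> ?I" for t i
  proof -
    obtain c where c: "r t i = c *\<^sub>R r t l"
      using parallel_eq_scaleR[OF rr[OF t i l] rl[OF t]] .
    then have "c = cross2 (r t i) (v t l) / cross2 (r t l) (v t l)"
      using k[OF t] by simp
    also have "\<dots> = \<mu> i"
      unfolding \<mu>_def using rv_const[OF t assms(8) i l] rv_const[OF t assms(8) l l] by simp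
    finally show ?thesis using c by simp
  qed

  show ?thesis
    unfolding homographic_def
  proof
    fix t assume t: "t \<in> T"
    obtain \<nu> :: real and \<Omega> :: "real^2^2"
      where "\<nu> > 0" "orthogonal_matrix \<Omega>" "r t l = \<nu> *\<^sub>R (\<Omega> *v r t0 l)"
      using exists_similarity[OF rl[OF assms(8)] rl[OF t]] .
    \<comment> \<open>The similarity found for body \<open>l\<close> alone serves all bodies: it is
      linear, and each body is \<open>\<mu> i\<close> times body \<open>l\<close> at both
      \<open>t\<close> and \<open>t0\<close>.\<close>
    then show "\<exists>\<nu>::real. \<exists>\<Omega>::real^2^2. \<nu> > 0 \<and> orthogonal_matrix \<Omega> \<and>
        (\<forall>i\<in>?I. r t i = \<nu> *\<^sub>R (\<Omega> *v r t0 i))"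
      using ratio[OF t] ratio[OF assms(8)]
      by (metis (no_types, opaque_lifting) matrix_vector_mult_scaleR scaleR_left_commute)
  qed
qed

end
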